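(* Let $E$ be a normed space, let $f\colon E\to E$, and let $p,q\in[1,+\infty)$. Assume that the composition operator $C_f$ maps $l^p(E)$ into $bv_q(E)$. Then $C_f\colon l^p(E)\to bv_q(E)$ is locally compact if and only if $f$ is a constant map.
   Context: $E$ is a normed space over $\mathbb R$ or $\mathbb C$ with norm $\|\cdot\|$. For a map $f\colon E\to E$, the composition operator $C_f$ assigns to a sequence $x\colon\mathbb N\to E$ the sequence $C_f(x)$ with $C_f(x)(n)=f(x(n))$ for all $n\in\mathbb N$. $l^p(E)$ is the space of sequences $x\colon\mathbb N\to E$ with $\|x\|_{l^p}=\bigl(\sum_{n=1}^\infty\|x(n)\|^p\bigr)^{1/p}<+\infty$. $bv_q(E)$ is the space of all sequences $x\colon\mathbb N\to E$ with $\sum_{n=1}^\infty\|x(n+1)-x(n)\|^q<+\infty$, with norm $\|x\|_{bv_q}=\|x(1)\|+\bigl(\sum_{n=1}^\infty\|x(n+1)-x(n)\|^q\bigr)^{1/q}$. A (not necessarily linear or continuous) map $F\colon X\to Y$ between normed spaces is locally compact if for every bounded subset $B$ of $X$ the image $F(B)$ is contained in a compact subset of $Y$. *)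

theory Defs
  imports "HOL-Analysis.Analysis"
begin

(* Sequences are indexed from 0 here, so "x 0" plays the role of x(1). Complex normed spaces are
   covered by restriction of scalars: none of the notions below uses scalar multiplication. *)

definition lp :: "real \<Rightarrow> (nat \<Rightarrow> 'a::real_normed_vector) set" where
  "lp p = {x. summable (\<lambda>n. norm (x n) powr p)}"

definition lp_norm :: "real \<Rightarrow> (nat \<Rightarrow> 'a::real_normed_vector) \<Rightarrow> real" where
  "lp_norm p x = (\<Sum>n. norm (x n) powr p) powr (1 / p)"

definition bv :: "real \<Rightarrow> (nat \<Rightarrow> 'a::real_normed_vector) set" where
  "bv q = {x. summable (\<lambda>n. norm (x (Suc n) - x n) powr q)}"

definition bv_norm :: "real \<Rightarrow> (nat \<Rightarrow> 'a::real_normed_vector) \<Rightarrow> real" where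
  "bv_norm q x = norm (x 0) + (\<Sum>n. norm (x (Suc n) - x n) powr q) powr (1 / q)"

definition comp_op :: "('a \<Rightarrow> 'a) \<Rightarrow> (nat \<Rightarrow> 'a) \<Rightarrow> (nat \<Rightarrow> 'a)" where
  "comp_op f x = (\<lambda>n. f (x n))"

(* "metric" is only meaningful if N induces a metric on V; for the spaces above this is
   proved in lp_metric_space and bv_metric_space. *)
definition norm_metric ::
  "(nat \<Rightarrow> 'a::real_normed_vector) set \<Rightarrow> ((nat \<Rightarrow> 'a) \<Rightarrow> real) \<Rightarrow> (nat \<Rightarrow> 'a) metric" where
  "norm_metric V N = metric (V, \<lambda>x y. N (\<lambda>n. x n - y n))"

(* Not related to local compactness of spaces: bounded sets go to subsets of compact sets. *)
definition locally_compact_map ::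
  "(nat \<Rightarrow> 'a::real_normed_vector) set \<Rightarrow> ((nat \<Rightarrow> 'a) \<Rightarrow> real) \<Rightarrow>
   (nat \<Rightarrow> 'b::real_normed_vector) set \<Rightarrow> ((nat \<Rightarrow> 'b) \<Rightarrow> real) \<Rightarrow>
   ((nat \<Rightarrow> 'a) \<Rightarrow> (nat \<Rightarrow> 'b)) \<Rightarrow> bool" where
  "locally_compact_map X NX Y NY F \<longleftrightarrow>
     (\<forall>B \<subseteq> X. (\<exists>C. \<forall>x\<in>B. NX x \<le> C) \<longrightarrow>
        (\<exists>K. compactin (mtopology_of (norm_metric Y NY)) K \<and> F ` B \<subseteq> K))"

lemma powr_convex_nonneg:
  fixes p t u v :: real
  assumes "p \<ge> 1" "0 \<le> t" "t \<le> 1" "0 \<le> u" "0 \<le> v"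
  shows "((1 - t) * u + t * v) powr p \<le> (1 - t) * u powr p + t * v powr p"
proof -
  have pw: "s powr p \<le> s" if "0 \<le> s" "s \<le> 1" for s :: real
    using powr_mono'[of 1 p s] assms(1) that by (cases "s = 0") auto
  consider "u = 0" | "v = 0" | "u > 0" "v > 0" using assms by linarith
  then show ?thesis
  proof cases
    case 1
    then show ?thesis using assms pw[of t] by (simp add: powr_mult mult_right_mono)
  next
    case 2
    then show ?thesis using assms pw[of "1 - t"] by (simp add: powr_mult mult_right_mono)
  next
    case 3
    then show ?thesis
      using convex_onD[OF powr_convex[OF assms(1)], of t u v] assms by simp
  qed
qed

lemma lp_norm_nonneg [simp]: "0 \<le> lp_norm p x"
  by (simp add: lp_norm_def)

lemma lp_norm_powr:
  assumes "x \<in> lp p" "p \<ge> 1"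
  shows "lp_norm p x powr p = (\<Sum>n. norm (x n) powr p)"
  using assms by (simp add: lp_norm_def lp_def powr_powr suminf_nonneg)

lemma lp_norm_eq_0_iff:
  assumes "x \<in> lp p" "p \<ge> 1"
  shows "lp_norm p x = 0 \<longleftrightarrow> (\<forall>n. x n = 0)"
proof -
  have "lp_norm p x = 0 \<longleftrightarrow> (\<Sum>n. norm (x n) powr p) = 0"
    using assms by (simp add: lp_norm_def)
  also have "\<dots> \<longleftrightarrow> (\<forall>n. norm (x n) powr p = 0)"
    using assms by (intro suminf_eq_zero_iff) (auto simp: lp_def)
  finally show ?thesis by simp
qed

lemma lp_minkowski:
  assumes x: "x \<in> lp p" and y: "y \<in> lp p" and p: "p \<ge> 1"
  shows "(\<lambda>n. x n + y n) \<in> lp p" "lp_norm p (\<lambda>n. x n + y n) \<le> lp_norm p x + lp_norm p y"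
proof -
  define a b where "a = lp_norm p x" and "b = lp_norm p y"
  have "(\<lambda>n. x n + y n) \<in> lp p \<and> lp_norm p (\<lambda>n. x n + y n) \<le> a + b"
  proof (cases "a = 0 \<or> b = 0")
    case True
    then have "(\<forall>n. x n = 0) \<or> (\<forall>n. y n = 0)"
      using lp_norm_eq_0_iff x y p by (auto simp: a_def b_def)
    then show ?thesis
    proof
      assume h: "\<forall>n. x n = 0"
      then show ?thesis using x y by (simp add: a_def b_def)
    next
      assume h: "\<forall>n. y n = 0"
      then show ?thesis using x y by (simp add: a_def b_def)
    qed
  next
    case False
    then have ab: "a > 0" "b > 0"
      using lp_norm_nonneg[of p x] lp_norm_nonneg[of p y] unfolding a_def b_def by linarith+
    define t where "t = b / (a + b)"
    have t: "0 \<le> t" "t \<le> 1" "(1 - t) = a / (a + b)"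
      using ab by (auto simp: t_def field_simps)
    define g where "g = (\<lambda>n. (a + b) powr p *
      ((1 - t) * (norm (x n) powr p / a powr p) + t * (norm (y n) powr p / b powr p)))"
    have le: "norm (x n + y n) powr p \<le> g n" for n
    proof -
      have e: "(1 - t) * (norm (x n) / a) + t * (norm (y n) / b) = (norm (x n) + norm (y n)) / (a + b)"
        unfolding t(3) using ab by (simp add: t_def add_divide_distrib)
      have "norm (x n + y n) powr p \<le> (norm (x n) + norm (y n)) powr p"
        using p by (intro powr_mono2 norm_triangle_ineq) auto
      also have "\<dots> = ((a + b) * ((1 - t) * (norm (x n) / a) + t * (norm (y n) / b))) powr p"
        unfolding e using ab by simp
      also have "\<dots> = (a + b) powr p * ((1 - t) * (norm (x n) / a) + t * (norm (y n) / b)) powr p"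
        by (rule powr_mult)
      also have "\<dots> \<le> (a + b) powr p *
          ((1 - t) * (norm (x n) / a) powr p + t * (norm (y n) / b) powr p)"
        using ab t p by (intro mult_left_mono powr_convex_nonneg) auto
      also have "\<dots> = g n"
        using ab by (simp add: g_def powr_divide)
      finally show ?thesis .
    qed
    have sx: "(\<lambda>n. norm (x n) powr p) sums (a powr p)"
      using x lp_norm_powr[OF x p] by (simp add: lp_def a_def summable_sums)
    have sy: "(\<lambda>n. norm (y n) powr p) sums (b powr p)"
      using y lp_norm_powr[OF y p] by (simp add: lp_def b_def summable_sums)
    have "g sums ((a + b) powr p * ((1 - t) * (a powr p / a powr p) + t * (b powr p / b powr p)))"
      unfolding g_def by (intro sums_mult sums_add sums_divide sx sy)
    then have sg: "g sums ((a + b) powr p)" using ab by simp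
    have s: "summable (\<lambda>n. norm (x n + y n) powr p)"
      by (rule summable_comparison_test'[OF sums_summable[OF sg], of 0]) (use le in auto)
    then have "(\<Sum>n. norm (x n + y n) powr p) \<le> (a + b) powr p"
      using suminf_le[OF le s sums_summable[OF sg]] sums_unique[OF sg] by simp
    then have "lp_norm p (\<lambda>n. x n + y n) \<le> ((a + b) powr p) powr (1 / p)"
      using p s unfolding lp_norm_def by (intro powr_mono2 suminf_nonneg) auto
    also have "\<dots> = a + b" using p ab by (simp add: powr_powr)
    finally show ?thesis using s by (simp add: lp_def)
  qed
  then show "(\<lambda>n. x n + y n) \<in> lp p" "lp_norm p (\<lambda>n. x n + y n) \<le> lp_norm p x + lp_norm p y"
    by (auto simp: a_def b_def)
qed

lemma lp_diff:
  assumes "x \<in> lp p" "y \<in> lp p" "p \<ge> 1"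
  shows "(\<lambda>n. x n - y n) \<in> lp p"
  using lp_minkowski(1)[of x p "\<lambda>n. - y n"] assms by (simp add: lp_def)

lemma lp_norm_commute: "lp_norm p (\<lambda>n. x n - y n) = lp_norm p (\<lambda>n. y n - x n)"
  by (simp add: lp_norm_def norm_minus_commute)

lemma bv_iff: "x \<in> bv q \<longleftrightarrow> (\<lambda>n. x (Suc n) - x n) \<in> lp q"
  by (simp add: bv_def lp_def)

lemma bv_norm_alt: "bv_norm q x = norm (x 0) + lp_norm q (\<lambda>n. x (Suc n) - x n)"
  by (simp add: bv_norm_def lp_norm_def)

lemma bv_norm_nonneg [simp]: "0 \<le> bv_norm q x"
  by (simp add: bv_norm_alt)

lemma bv_diff:
  assumes "x \<in> bv q" "y \<in> bv q" "q \<ge> 1"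
  shows "(\<lambda>n. x n - y n) \<in> bv q"
proof -
  have "(\<lambda>n. (x (Suc n) - x n) - (y (Suc n) - y n)) \<in> lp q"
    using lp_diff[of "\<lambda>n. x (Suc n) - x n" q "\<lambda>n. y (Suc n) - y n"] assms by (simp add: bv_iff)
  then show ?thesis by (simp add: bv_iff algebra_simps)
qed

lemma bv_minkowski:
  assumes "x \<in> bv q" "y \<in> bv q" "q \<ge> 1"
  shows "bv_norm q (\<lambda>n. x n + y n) \<le> bv_norm q x + bv_norm q y"
proof -
  have "lp_norm q (\<lambda>n. (x (Suc n) - x n) + (y (Suc n) - y n)) \<le>
      lp_norm q (\<lambda>n. x (Suc n) - x n) + lp_norm q (\<lambda>n. y (Suc n) - y n)"
    using assms by (intro lp_minkowski(2)) (auto simp: bv_iff)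
  moreover have "(\<lambda>n. (x (Suc n) - x n) + (y (Suc n) - y n)) =
      (\<lambda>n. x (Suc n) + y (Suc n) - (x n + y n))"
    by (simp add: algebra_simps)
  ultimately show ?thesis
    using norm_triangle_ineq[of "x 0" "y 0"] by (simp add: bv_norm_alt)
qed

lemma bv_norm_eq_0_iff:
  assumes "x \<in> bv q" "q \<ge> 1"
  shows "bv_norm q x = 0 \<longleftrightarrow> (\<forall>n. x n = 0)"
proof
  assume "bv_norm q x = 0"
  then have "norm (x 0) = 0" "lp_norm q (\<lambda>n. x (Suc n) - x n) = 0"
    using lp_norm_nonneg[of q "\<lambda>n. x (Suc n) - x n"] norm_ge_zero[of "x 0"]
    unfolding bv_norm_alt by linarith+
  then have "x 0 = 0" "\<And>n. x (Suc n) = x n"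
    using lp_norm_eq_0_iff[of "\<lambda>n. x (Suc n) - x n" q] assms by (auto simp: bv_iff)
  then have "x n = 0" for n by (induction n) auto
  then show "\<forall>n. x n = 0" by blast
qed (simp add: bv_norm_def)

lemma lp_metric_space:
  assumes "p \<ge> 1"
  shows "Metric_space (lp p) (\<lambda>x y :: nat \<Rightarrow> 'a::real_normed_vector. lp_norm p (\<lambda>n. x n - y n))"
proof
  fix x y z :: "nat \<Rightarrow> 'a"
  show "lp_norm p (\<lambda>n. x n - y n) = lp_norm p (\<lambda>n. y n - x n)" by (rule lp_norm_commute)
  show "(lp_norm p (\<lambda>n. x n - y n) = 0) = (x = y)" if "x \<in> lp p" "y \<in> lp p"
    using lp_norm_eq_0_iff[OF lp_diff[OF that assms] assms] by auto
  show "lp_norm p (\<lambda>n. x n - z n) \<le> lp_norm p (\<lambda>n. x n - y n) + lp_norm p (\<lambda>n. y n - z n)"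
    if "x \<in> lp p" "y \<in> lp p" "z \<in> lp p"
    using lp_minkowski(2)[OF lp_diff[OF that(1,2) assms] lp_diff[OF that(2,3) assms] assms] by simp
qed simp

lemma bv_metric_space:
  assumes "q \<ge> 1"
  shows "Metric_space (bv q) (\<lambda>x y :: nat \<Rightarrow> 'a::real_normed_vector. bv_norm q (\<lambda>n. x n - y n))"
proof
  fix x y z :: "nat \<Rightarrow> 'a"
  have e: "norm (x (Suc n) - y (Suc n) - (x n - y n)) = norm (y (Suc n) - x (Suc n) - (y n - x n))" for n
  proof -
    have "y (Suc n) - x (Suc n) - (y n - x n) = - (x (Suc n) - y (Suc n) - (x n - y n))"
      by simp
    then show ?thesis by (simp only: norm_minus_cancel)
  qed
  show "bv_norm q (\<lambda>n. x n - y n) = bv_norm q (\<lambda>n. y n - x n)"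
    unfolding bv_norm_def e by (simp add: norm_minus_commute)
  show "(bv_norm q (\<lambda>n. x n - y n) = 0) = (x = y)" if "x \<in> bv q" "y \<in> bv q"
    using bv_norm_eq_0_iff[OF bv_diff[OF that assms] assms] by auto
  show "bv_norm q (\<lambda>n. x n - z n) \<le> bv_norm q (\<lambda>n. x n - y n) + bv_norm q (\<lambda>n. y n - z n)"
    if "x \<in> bv q" "y \<in> bv q" "z \<in> bv q"
    using bv_minkowski[OF bv_diff[OF that(1,2) assms] bv_diff[OF that(2,3) assms] assms] by simp
qed simp

end

theory Submission
  imports Defs
begin

text \<open>
  If \<open>f u \<noteq> f 0\<close>, the sequences carrying \<open>u\<close> at a single place and \<open>0\<close> elsewhere are
  bounded in \<open>l\<^sup>p\<close>, but \<open>C\<^sub>f\<close> maps them to sequences whose mutual \<open>bv\<^sub>q\<close>-distances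
  are at least \<open>\<parallel>f u - f 0\<parallel>\<close>. Such a family has no Cauchy subsequence, hence lies in no compact set.
\<close>

text \<open>\<open>metric\<close> returns the intended metric only for pairs satisfying the metric
  axioms, which \<open>bv_metric_space\<close> supplies. This makes the locale
  \<open>Metric_space\<close> available for the topology in
  \<open>locally_compact_map\<close>.\<close>

lemma mtopology_of_norm_metric_bv:
  assumes "q \<ge> 1"
  shows "mtopology_of (norm_metric (bv q) (bv_norm q :: (nat \<Rightarrow> 'a::real_normed_vector) \<Rightarrow> real)) =
    Metric_space.mtopology (bv q) (\<lambda>x y. bv_norm q (\<lambda>n. x n - y n))"
proof -
  interpret Metric_space "bv q" "\<lambda>x y :: nat \<Rightarrow> 'a. bv_norm q (\<lambda>n. x n - y n)"
    by (rule bv_metric_space[OF assms])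
  show ?thesis
    by (simp add: norm_metric_def mtopology_of)
qed

text \<open>Sequential compactness would give a convergent, hence Cauchy, subsequence; but its
  consecutive terms have distinct indices and so stay at least \<epsilon> apart.\<close>

lemma (in Metric_space) separated_sequence_not_compactin:
  fixes s :: "nat \<Rightarrow> 'a"
  assumes "\<epsilon> > 0" and sep: "\<And>k m. k \<noteq> m \<Longrightarrow> \<epsilon> \<le> d (s k) (s m)" and "range s \<subseteq> K"
  shows "\<not> compactin mtopology K"
proof
  assume "compactin mtopology K"
  then obtain l r where l: "l \<in> K" "strict_mono (r :: nat \<Rightarrow> nat)"
    "limitin mtopology (s \<circ> r) l sequentially" and "K \<subseteq> M"
    using assms(3) unfolding compactin_sequentially by blast
  then have "MCauchy (s \<circ> r)"
    using assms(3) by (intro convergent_imp_MCauchy) auto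
  then obtain N where "\<forall>n n'. N \<le> n \<longrightarrow> N \<le> n' \<longrightarrow> d ((s \<circ> r) n) ((s \<circ> r) n') < \<epsilon>"
    using \<open>\<epsilon> > 0\<close> unfolding MCauchy_def by blast
  then have "d (s (r N)) (s (r (Suc N))) < \<epsilon>"
    by simp
  moreover have "r N \<noteq> r (Suc N)"
    using l(2) by (metis lessI less_irrefl strict_mono_def)
  ultimately show False
    using sep by force
qed

text \<open>One term of a convergent nonnegative series is at most its sum. This allows a
  \<open>bv_norm\<close> to be bounded below through a single increment.\<close>

lemma norm_diff_le_bv_norm:
  assumes "z \<in> bv q" "q \<ge> 1"
  shows "norm (z (Suc n) - z n) \<le> bv_norm q z"
proof -
  have "norm (z (Suc n) - z n) powr q \<le> (\<Sum>n. norm (z (Suc n) - z n) powr q)"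
    using assms sum_le_suminf[of "\<lambda>n. norm (z (Suc n) - z n) powr q" "{n}"] by (simp add: bv_def)
  then have "(norm (z (Suc n) - z n) powr q) powr (1 / q) \<le>
      (\<Sum>n. norm (z (Suc n) - z n) powr q) powr (1 / q)"
    using assms by (intro powr_mono2) auto
  then show ?thesis
    using assms by (simp add: powr_powr bv_norm_def add_increasing)
qed

lemma single_in_lp: "(\<lambda>n. if n = k then u else 0) \<in> lp p"
proof -
  have "summable (\<lambda>n. norm (if n = k then u else 0) powr p)"
    by (rule summable_finite[of "{k}"]) auto
  then show ?thesis
    by (simp add: lp_def)
qed

lemma lp_norm_single:
  assumes "p \<ge> 1"
  shows "lp_norm p (\<lambda>n. if n = k then u else 0) = norm u"
proof -
  have "(\<Sum>n. norm (if n = k then u else 0) powr p) = (\<Sum>n\<in>{k}. norm (if n = k then u else 0) powr p)"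
    by (rule suminf_finite) auto
  then show ?thesis
    using assms by (simp add: lp_norm_def powr_powr)
qed

theorem theorem41:
  fixes f :: "'a::real_normed_vector \<Rightarrow> 'a" and p q :: real
  assumes "1 \<le> p" and "1 \<le> q"
    and "comp_op f ` lp p \<subseteq> bv q"
  shows "locally_compact_map (lp p) (lp_norm p) (bv q) (bv_norm q) (comp_op f) \<longleftrightarrow>
    f constant_on UNIV"
proof -
  interpret Metric_space "bv q" "\<lambda>x y :: nat \<Rightarrow> 'a. bv_norm q (\<lambda>n. x n - y n)"
    by (rule bv_metric_space[OF assms(2)])
  show ?thesis
  proof
    assume "f constant_on UNIV"
    then obtain c where c: "\<And>x. f x = c"
      by (auto simp: constant_on_def)
    have "(\<lambda>n. c) \<in> bv q"
      by (simp add: bv_def)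
    \<comment> \<open>One singleton serves as the compact set for every \<open>B\<close>.\<close>
    then have "compactin mtopology {\<lambda>n. c}"
      by (simp add: finite_imp_compactin)
    moreover have "comp_op f ` B \<subseteq> {\<lambda>n. c}" for B
      using c by (auto simp: comp_op_def)
    ultimately show "locally_compact_map (lp p) (lp_norm p) (bv q) (bv_norm q) (comp_op f)"
      unfolding locally_compact_map_def mtopology_of_norm_metric_bv[OF assms(2)] by blast
  next
    assume lc: "locally_compact_map (lp p) (lp_norm p) (bv q) (bv_norm q) (comp_op f)"
    have "f u = f 0" for u
    proof (rule ccontr)
      assume neq: "f u \<noteq> f 0"
      define x where "x = (\<lambda>k n :: nat. if n = k then u else 0)"
      have x_lp: "range x \<subseteq> lp p"
        by (auto simp: x_def single_in_lp)
      have "\<forall>y\<in>range x. lp_norm p y \<le> norm u"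
        using assms(1) by (auto simp: x_def lp_norm_single)
      then obtain K where K: "compactin mtopology K" "comp_op f ` range x \<subseteq> K"
        using lc x_lp unfolding locally_compact_map_def mtopology_of_norm_metric_bv[OF assms(2)]
        by blast
      have "norm (f u - f 0) \<le> bv_norm q (\<lambda>n. comp_op f (x k) n - comp_op f (x m) n)"
        if "k \<noteq> m" for k m
      proof -
        define z where "z = (\<lambda>n. comp_op f (x k) n - comp_op f (x m) n)"
        \<comment> \<open>Membership guarantees that the series in \<open>bv_norm q z\<close>
          converges, so that its \<open>suminf\<close> is a genuine sum.\<close>
        have "z \<in> bv q"
          unfolding z_def using assms x_lp by (intro bv_diff) blast+
        \<comment> \<open>From \<open>k\<close> to \<open>Suc k\<close> the sequence
          \<open>x k\<close> drops from \<open>u\<close> to \<open>0\<close>. The sequence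
          \<open>x m\<close> stays at \<open>0\<close>, except that it rises to \<open>u\<close> if
          \<open>m = Suc k\<close>, which doubles the increment.\<close>
        have "z (Suc k) - z k = - (f u - f 0) \<or> z (Suc k) - z k = - (2 *\<^sub>R (f u - f 0))"
          using that by (auto simp: z_def comp_op_def x_def scaleR_2)
        then have "norm (f u - f 0) \<le> norm (z (Suc k) - z k)"
          by (elim disjE) (simp_all only: norm_minus_cancel norm_scaleR, simp)
        also have "\<dots> \<le> bv_norm q z"
          using \<open>z \<in> bv q\<close> assms(2) by (rule norm_diff_le_bv_norm)
        finally show ?thesis
          by (simp add: z_def)
      qed
      then have "\<not> compactin mtopology K"
        using neq K(2)
        by (intro separated_sequence_not_compactin[of "norm (f u - f 0)" "\<lambda>k. comp_op f (x k)"]) auto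
      then show False
        using K(1) by contradiction
    qed
    then show "f constant_on UNIV"
      by (auto simp: constant_on_def)
  qed
qed

end
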